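(* Let $\lambda>0$. Any two independent network random walks $S,S'$ on $\Gamma_2(\lambda)$ (with any starting vertices) almost surely have infinitely many intersections, i.e. there are infinitely many pairs $(m,m')\in\mathbb{Z}_+^2$ with $S_m=S'_{m'}$.
   Context: $\Gamma_2(\lambda)$ is the nearest-neighbour lattice graph on $\mathbb{Z}^{3}=\mathbb{Z}\times\mathbb{Z}^2$ with conductance $\mu((n,x),(n',x'))=e^{\lambda\max(n,n')}$ on each edge $(n,x)\sim(n',x')$. The network random walk is the Markov chain which jumps to a neighbour with probability proportional to the conductance of the connecting edge; equivalently, its i.i.d. steps equal $(1,0,0)$ with probability $e^\lambda/(5+e^\lambda)$ and each of the other $5$ signed unit vectors with probability $1/(5+e^\lambda)$. *)

theory Defs
  imports "HOL-Probability.Probability"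
begin

text \<open>A network is given by an adjacency relation \<open>E\<close>, assumed locally finite (otherwise the sum
  below is \<open>0\<close> by convention), and a conductance function \<open>c\<close> whose values matter only on edges.\<close>

definition network_step_prob ::
    "('v \<Rightarrow> 'v \<Rightarrow> bool) \<Rightarrow> ('v \<Rightarrow> 'v \<Rightarrow> real) \<Rightarrow> 'v \<Rightarrow> 'v \<Rightarrow> real" where
  "network_step_prob E c x y = (if E x y then c x y / (\<Sum>z | E x z. c x z) else 0)"

text \<open>The Markov property is stated for conditioning on every past trajectory of positive
  probability.\<close>

definition network_random_walk ::
    "'w measure \<Rightarrow> ('v \<Rightarrow> 'v \<Rightarrow> bool) \<Rightarrow> ('v \<Rightarrow> 'v \<Rightarrow> real) \<Rightarrow> 'v \<Rightarrow> (nat \<Rightarrow> 'w \<Rightarrow> 'v) \<Rightarrow> bool" where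
  "network_random_walk M E c v S \<longleftrightarrow>
     prob_space M \<and>
     (\<forall>n. S n \<in> measurable M (count_space UNIV)) \<and>
     (AE \<omega> in M. S 0 \<omega> = v) \<and>
     (\<forall>n x y. \<P>(\<omega> in M. \<forall>i\<le>n. S i \<omega> = x i) > 0 \<longrightarrow>
        \<P>(\<omega> in M. S (Suc n) \<omega> = y \<bar> \<forall>i\<le>n. S i \<omega> = x i) = network_step_prob E c (x n) y)"

text \<open>Independence of the two trajectories as random elements of the product sigma-algebra
  on \<open>nat \<Rightarrow> 'v\<close>.\<close>

definition independent_processes ::
    "'w measure \<Rightarrow> (nat \<Rightarrow> 'w \<Rightarrow> 'v) \<Rightarrow> (nat \<Rightarrow> 'w \<Rightarrow> 'v) \<Rightarrow> bool" where
  "independent_processes M S S' \<longleftrightarrow>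
     prob_space.indep_var M
       (PiM UNIV (\<lambda>_. count_space UNIV)) (\<lambda>\<omega> n. S n \<omega>)
       (PiM UNIV (\<lambda>_. count_space UNIV)) (\<lambda>\<omega> n. S' n \<omega>)"

type_synonym vertex = "int \<times> int \<times> int"

fun lattice_adj :: "vertex \<Rightarrow> vertex \<Rightarrow> bool" where
  "lattice_adj (n, a, b) (n', a', b') \<longleftrightarrow> \<bar>n - n'\<bar> + \<bar>a - a'\<bar> + \<bar>b - b'\<bar> = 1"

definition Gamma2_conductance :: "real \<Rightarrow> vertex \<Rightarrow> vertex \<Rightarrow> real" where
  "Gamma2_conductance lam u v = exp (lam * of_int (max (fst u) (fst v)))"

lemma int_sum_eq_1_cases:
  fixes x y z :: int
  assumes "x + y + z = 1" "x \<ge> 0" "y \<ge> 0" "z \<ge> 0"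
  shows "x = 1 \<and> y = 0 \<and> z = 0 \<or> x = 0 \<and> y = 1 \<and> z = 0 \<or> x = 0 \<and> y = 0 \<and> z = 1"
proof -
  have "x = 0 \<or> x = 1" "y = 0 \<or> y = 1" using assms by linarith+
  then show ?thesis using assms by auto
qed

lemma lattice_neighbours:
  "{z. lattice_adj (n, a, b) z} =
     {(n + 1, a, b), (n - 1, a, b), (n, a + 1, b), (n, a - 1, b), (n, a, b + 1), (n, a, b - 1)}"
proof -
  have "z = (n + 1, a, b) \<or> z = (n - 1, a, b) \<or> z = (n, a + 1, b) \<or> z = (n, a - 1, b)
      \<or> z = (n, a, b + 1) \<or> z = (n, a, b - 1)" if "lattice_adj (n, a, b) z" for z
  proof -
    obtain p q r where z: "z = (p, q, r)" by (cases z) auto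
    have "\<bar>n - p\<bar> + \<bar>a - q\<bar> + \<bar>b - r\<bar> = 1" using that z by simp
    then consider "\<bar>n - p\<bar> = 1" "q = a" "r = b" | "p = n" "\<bar>a - q\<bar> = 1" "r = b"
      | "p = n" "q = a" "\<bar>b - r\<bar> = 1"
      using int_sum_eq_1_cases[of "\<bar>n - p\<bar>" "\<bar>a - q\<bar>" "\<bar>b - r\<bar>"]
      by (simp only: abs_ge_zero abs_eq_0 right_minus_eq) blast
    then show ?thesis
    proof cases
      case 1
      then have "p = n + 1 \<or> p = n - 1" by linarith
      with 1 show ?thesis unfolding z by blast
    next
      case 2
      then have "q = a + 1 \<or> q = a - 1" by linarith
      with 2 show ?thesis unfolding z by blast
    next
      case 3
      then have "r = b + 1 \<or> r = b - 1" by linarith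
      with 3 show ?thesis unfolding z by blast
    qed
  qed
  moreover have "lattice_adj (n, a, b) (n + 1, a, b)" "lattice_adj (n, a, b) (n - 1, a, b)"
    "lattice_adj (n, a, b) (n, a + 1, b)" "lattice_adj (n, a, b) (n, a - 1, b)"
    "lattice_adj (n, a, b) (n, a, b + 1)" "lattice_adj (n, a, b) (n, a, b - 1)"
    by simp_all
  ultimately show ?thesis by blast
qed

lemma Gamma2_step_prob:
  "network_step_prob lattice_adj (Gamma2_conductance lam) (n, a, b) z =
     (if z = (n + 1, a, b) then exp lam / (5 + exp lam)
      else if lattice_adj (n, a, b) z then 1 / (5 + exp lam) else 0)"
proof -
  have E: "exp (lam * of_int (n + 1)) = exp (lam * of_int n) * exp lam"
    by (simp add: distrib_left exp_add)
  have total: "(\<Sum>w | lattice_adj (n, a, b) w. Gamma2_conductance lam (n, a, b) w)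
      = exp (lam * of_int n) * (5 + exp lam)"
    unfolding lattice_neighbours using E by (simp add: Gamma2_conductance_def algebra_simps max_def)
  show ?thesis
  proof (cases "lattice_adj (n, a, b) z")
    case False
    then show ?thesis by (auto simp: network_step_prob_def)
  next
    case True
    then have "z \<in> {z. lattice_adj (n, a, b) z}" by simp
    then consider "z = (n + 1, a, b)" | "fst z \<le> n" "z \<noteq> (n + 1, a, b)"
      unfolding lattice_neighbours by auto
    then show ?thesis
    proof cases
      case 1
      then show ?thesis
        using True E unfolding network_step_prob_def total by (simp add: Gamma2_conductance_def max_def)
    next
      case 2
      then show ?thesis
        using True unfolding network_step_prob_def total by (simp add: Gamma2_conductance_def max_def)
    qed
  qed
qed

end

(* The drift makes the walk visit every level n (first coordinate equal to n). Let X_n be the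
   horizontal position at the first visit to level n, and X'_n that of the other walk. Both are random
   walks on Z^2 with i.i.d. increments of the same law and finite second moment, so for equal starting
   points the Cauchy-Schwarz inequality and Markov's inequality give
   P(X_n = X'_n) = sum_x P(X_n = x)^2 >= (1/2)^2 / #{x : |x|^2 <= C n} >= c/n.
   Since sum 1/n diverges, X - X' is recurrent, hence two independent walks intersect almost surely from
   any starting points; applied to the walks after time N, for every N, this gives infinitely many
   intersections. The probability h(v, v') of an intersection is superharmonic in both arguments,
   which replaces the strong Markov property at the first visits. *)
theory Submission
  imports Defs
begin

section \<open>Meetings of two random walks on an abelian group\<close>

text \<open>By monotone convergence the pointwise supremum of the masses on \<open>A\<close> is a
  density, and \<open>mass\<close> makes its total exactly 1. The law at a stopping time arises this
  way from laws at fixed times, without an infinite path space.\<close>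

lemma pmf_monotone_limit:
  fixes Q :: "nat \<Rightarrow> 'a pmf"
  assumes mono: "\<And>N x. x \<in> A \<Longrightarrow> pmf (Q N) x \<le> pmf (Q (Suc N)) x"
    and mass: "(SUP N. emeasure (Q N) A) = 1"
  obtains g :: "'a pmf" where
    "\<And>F. (\<integral>\<^sup>+x. F x \<partial>g) = (SUP N. \<integral>\<^sup>+x. F x * indicator A x \<partial>Q N)"
proof -
  define h where "h x = (SUP N. ennreal (pmf (Q N) x) * indicator A x)" for x
  have inc: "incseq (\<lambda>N x. ennreal (pmf (Q N) x) * indicator A x * F x)" for F
    by (intro incseq_SucI le_funI) (auto simp: indicator_def intro!: mult_right_mono ennreal_leI mono)
  have h_int: "(\<integral>\<^sup>+x. h x * F x \<partial>count_space UNIV) = (SUP N. \<integral>\<^sup>+x. F x * indicator A x \<partial>Q N)" for F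
  proof -
    have "(\<integral>\<^sup>+x. h x * F x \<partial>count_space UNIV)
        = (\<integral>\<^sup>+x. (SUP N. ennreal (pmf (Q N) x) * indicator A x * F x) \<partial>count_space UNIV)"
      by (simp add: h_def SUP_mult_right_ennreal)
    also have "\<dots> = (SUP N. \<integral>\<^sup>+x. ennreal (pmf (Q N) x) * indicator A x * F x \<partial>count_space UNIV)"
      by (rule nn_integral_monotone_convergence_SUP[OF inc]) simp
    also have "\<dots> = (SUP N. \<integral>\<^sup>+x. F x * indicator A x \<partial>Q N)"
      by (simp add: nn_integral_measure_pmf mult_ac)
    finally show ?thesis .
  qed
  have h_le: "h x \<le> 1" for x
    unfolding h_def by (intro SUP_least) (auto simp: indicator_def pmf_le_1)
  then have h_fin: "ennreal (enn2real (h x)) = h x" for x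
    by (metis ennreal_enn2real ennreal_one_less_top order_le_less_trans)
  have "(\<integral>\<^sup>+x. h x \<partial>count_space UNIV) = 1"
    using h_int[of "\<lambda>_. 1"] mass by simp
  then have "pmf (embed_pmf (\<lambda>x. enn2real (h x))) x = enn2real (h x)" for x
    by (intro pmf_embed_pmf) (simp_all add: h_fin)
  then have "(\<integral>\<^sup>+x. F x \<partial>embed_pmf (\<lambda>x. enn2real (h x))) = (SUP N. \<integral>\<^sup>+x. F x * indicator A x \<partial>Q N)" for F
    by (simp add: nn_integral_measure_pmf h_fin h_int)
  then show thesis by (rule that)
qed

text \<open>Cauchy-Schwarz for the point masses on \<open>B\<close> against the constant 1; the sum
  of their squares is the mass of the diagonal over \<open>B\<close>.\<close>

lemma pair_pmf_diagonal_ge: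
  assumes "finite B"
  shows "(measure (measure_pmf X) B)\<^sup>2 \<le> real (card B) * measure (pair_pmf X X) {(x, y). x = y}"
proof -
  have "(measure X B)\<^sup>2 = (\<Sum>x\<in>B. 1 * pmf X x)\<^sup>2"
    using assms by (simp add: measure_measure_pmf_finite)
  also have "\<dots> \<le> (\<Sum>x\<in>B. 1\<^sup>2) * (\<Sum>x\<in>B. (pmf X x)\<^sup>2)"
    by (rule Cauchy_Schwarz_ineq_sum)
  also have "(\<Sum>x\<in>B. (pmf X x)\<^sup>2) = (\<Sum>z\<in>(\<lambda>x. (x, x)) ` B. pmf (pair_pmf X X) z)"
    by (subst sum.reindex) (auto simp: inj_on_def pmf_pair power2_eq_square)
  also have "\<dots> = measure (pair_pmf X X) ((\<lambda>x. (x, x)) ` B)"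
    using assms by (simp add: measure_measure_pmf_finite)
  also have "\<dots> \<le> measure (pair_pmf X X) {(x, y). x = y}"
    by (intro measure_pmf.finite_measure_mono) auto
  finally show ?thesis by (simp add: mult_left_mono)
qed

section \<open>Convolution powers, meetings at equal times and recurrence\<close>

primrec conv_power :: "'a::ab_group_add pmf \<Rightarrow> nat \<Rightarrow> 'a pmf" where
  "conv_power g 0 = return_pmf 0"
| "conv_power g (Suc n) = bind_pmf g (\<lambda>y. map_pmf ((+) y) (conv_power g n))"

text \<open>The recursion puts the new increment first; commutativity lets it come last, as the
  induction on second moments requires.\<close>

lemma conv_power_Suc': "conv_power g (Suc n) = bind_pmf (conv_power g n) (\<lambda>x. map_pmf ((+) x) g)"
proof -
  have "conv_power g (Suc n) = bind_pmf (conv_power g n) (\<lambda>x. bind_pmf g (\<lambda>y. return_pmf (y + x)))"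
    by (simp add: map_pmf_def bind_commute_pmf[of g])
  then show ?thesis by (simp add: map_pmf_def add.commute)
qed

text \<open>The \<open>n\<close>-step probability that the difference walk passes from
  \<open>x\<close> to 0. Working with the pair avoids a separate law for differences of
  increments.\<close>

definition meet :: "'a::ab_group_add pmf \<Rightarrow> nat \<Rightarrow> 'a \<Rightarrow> ennreal" where
  "meet g n x = emeasure (pair_pmf (conv_power g n) (conv_power g n)) {(y, y'). x + y = y'}"

lemma meet_0: "meet g 0 x = indicator {0} x"
  by (simp add: meet_def pair_return_pmf1 indicator_def)


lemma pair_bind_pmf:
  "pair_pmf (bind_pmf p f) (bind_pmf q k) = bind_pmf p (\<lambda>x. bind_pmf q (\<lambda>y. pair_pmf (f x) (k y)))"
proof -
  have "pair_pmf (bind_pmf p f) (bind_pmf q k)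
      = bind_pmf p (\<lambda>x. bind_pmf (f x) (\<lambda>a. bind_pmf q (\<lambda>y. bind_pmf (k y) (\<lambda>b. return_pmf (a, b)))))"
    by (simp add: pair_pmf_def bind_assoc_pmf)
  also have "\<dots> = bind_pmf p (\<lambda>x. bind_pmf q (\<lambda>y. pair_pmf (f x) (k y)))"
    unfolding pair_pmf_def by (subst bind_commute_pmf) (rule refl)
  finally show ?thesis .
qed

text \<open>First-step decomposition: initial increments \<open>y\<close> and \<open>y'\<close>
  change the difference of the two walks from \<open>x\<close> to \<open>x + y - y'\<close>.\<close>

lemma meet_Suc:
  fixes g :: "'a::ab_group_add pmf"
  shows "meet g (Suc n) x = (\<integral>\<^sup>+y. \<integral>\<^sup>+y'. meet g n (x + y - y') \<partial>g \<partial>g)"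
proof -
  have "{(z, z'). x + y + z = y' + z'} = {(z, z'). x + y - y' + z = z'}" for y y'
    by (auto simp: algebra_simps)
  then show ?thesis
    by (simp add: meet_def pair_bind_pmf map_pair[symmetric] vimage_def case_prod_beta' add.assoc[symmetric])
qed

text \<open>A Green function argument for the difference walk:
  \<open>G n x \<le> h x * G n 0\<close>, so \<open>r < 1\<close> would bound the expected number of
  meetings by a geometric series. Hence \<open>h\<close> has mean 1 after one step and, being at
  most 1, equals 1 at every difference reached in one step.\<close>

lemma recurrent_meeting:
  fixes g :: "'a::ab_group_add pmf" and h :: "'a \<Rightarrow> ennreal"
  assumes h0: "h 0 = 1" and h_le: "\<And>x. h x \<le> 1"
    and super: "\<And>x. (\<integral>\<^sup>+y. \<integral>\<^sup>+y'. h (x + y - y') \<partial>g \<partial>g) \<le> h x"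
    and rec: "(\<Sum>n. meet g n 0) = \<infinity>"
    and y: "y \<in> set_pmf g" and y': "y' \<in> set_pmf g"
  shows "h (y - y') = 1"
proof -
  define G where "G n x = (\<Sum>k\<le>n. meet g k x)" for n x
  define r where "r = (\<integral>\<^sup>+y. \<integral>\<^sup>+y'. h (y - y') \<partial>g \<partial>g)"
  have G_0: "G 0 x = indicator {0} x" for x by (simp add: G_def meet_0)
  have G_Suc: "G (Suc n) x = indicator {0} x + (\<integral>\<^sup>+y. \<integral>\<^sup>+y'. G n (x + y - y') \<partial>g \<partial>g)" for n x
    unfolding G_def
    by (subst sum.atMost_Suc_shift) (simp add: meet_0 meet_Suc nn_integral_sum)
  have G_mono: "G n x \<le> G (Suc n) x" for n x by (simp add: G_def)
  \<comment> \<open>a path starting at \<open>x\<close> collects visits to \<open>0\<close> only after its first visit\<close>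
  have G_le: "G n x \<le> h x * G n 0" for n x
  proof (induction n arbitrary: x)
    case 0
    then show ?case by (simp add: G_0 indicator_def h0)
  next
    case (Suc n)
    show ?case
    proof (cases "x = 0")
      case False
      then have "G (Suc n) x \<le> (\<integral>\<^sup>+y. \<integral>\<^sup>+y'. h (x + y - y') * G n 0 \<partial>g \<partial>g)"
        unfolding G_Suc by (simp add: nn_integral_mono Suc.IH)
      also have "\<dots> = (\<integral>\<^sup>+y. \<integral>\<^sup>+y'. h (x + y - y') \<partial>g \<partial>g) * G n 0"
        by (simp add: nn_integral_multc)
      also have "\<dots> \<le> h x * G (Suc n) 0"
        by (intro mult_mono super G_mono) auto
      finally show ?thesis .
    qed (simp add: h0)
  qed
  have G_step: "G (Suc n) 0 \<le> 1 + r * G n 0" for n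
  proof -
    have "(\<integral>\<^sup>+y. \<integral>\<^sup>+y'. G n (0 + y - y') \<partial>g \<partial>g) \<le> (\<integral>\<^sup>+y. \<integral>\<^sup>+y'. h (y - y') * G n 0 \<partial>g \<partial>g)"
      by (simp add: nn_integral_mono G_le)
    then show ?thesis
      unfolding G_Suc r_def by (simp add: nn_integral_multc)
  qed
  have r_le: "r \<le> 1"
  proof -
    have "r \<le> (\<integral>\<^sup>+y. \<integral>\<^sup>+y'. 1 \<partial>g \<partial>g)"
      unfolding r_def by (intro nn_integral_mono h_le)
    then show ?thesis by simp
  qed
  have "r = 1"
  proof (rule ccontr)
    assume "r \<noteq> 1"
    obtain \<rho> where \<rho>: "r = ennreal \<rho>" "0 \<le> \<rho>" "\<rho> < 1"
      using r_le \<open>r \<noteq> 1\<close> by (cases r) (auto simp: top_unique)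
    \<comment> \<open>The bound is the fixed point of t -> 1 + \<rho> t, so \<open>G_step\<close>
      preserves it.\<close>
    have G_bd: "G n 0 \<le> ennreal (1 / (1 - \<rho>))" for n
    proof (induction n)
      case 0
      then show ?case using \<rho> by (simp add: G_0 field_simps flip: ennreal_1)
    next
      case (Suc n)
      have "G (Suc n) 0 \<le> 1 + ennreal \<rho> * ennreal (1 / (1 - \<rho>))"
        using G_step[of n] Suc.IH \<rho> by (meson add_left_mono mult_left_mono order_trans zero_le)
      also have "\<dots> = ennreal (1 / (1 - \<rho>))"
        using \<rho> by (simp add: field_simps flip: ennreal_1 ennreal_mult'' ennreal_plus)
      finally show ?case .
    qed
    have "(\<Sum>n. meet g n 0) \<le> ennreal (1 / (1 - \<rho>))"
    proof (rule suminf_le_const)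
      fix n
      have "(\<Sum>k<n. meet g k 0) \<le> G n 0"
        unfolding G_def by (intro sum_mono2) auto
      then show "(\<Sum>k<n. meet g k 0) \<le> ennreal (1 / (1 - \<rho>))"
        using G_bd order_trans by blast
    qed simp
    with rec show False by (simp add: top_unique)
  qed
  have "(\<integral>\<^sup>+z. h (fst z - snd z) \<partial>pair_pmf g g) = 1"
    using \<open>r = 1\<close> by (simp add: nn_integral_pair_pmf' r_def)
  then have "(\<integral>\<^sup>+z. 1 - h (fst z - snd z) \<partial>pair_pmf g g) = 0"
    by (subst nn_integral_diff) (auto simp: h_le)
  \<comment> \<open>Since \<open>h\<close> is at most 1, its mean value 1 forces equality at every
    atom of the pair law.\<close>
  then have "AE z in pair_pmf g g. 1 - h (fst z - snd z) = 0"
    by (simp add: nn_integral_0_iff_AE)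
  with y y' have "1 - h (y - y') = 0"
    by (auto simp: AE_measure_pmf_iff)
  with h_le show ?thesis
    by (metis antisym diff_eq_0_iff_ennreal ennreal_one_less_top infinity_ennreal_def top.not_eq_extremum)
qed

section \<open>Intersections of trajectories\<close>

text \<open>Finite lists keep everything discrete; the measure space of the walks enters only in the
  last section. The start is included, so the list has \<open>Suc N\<close> entries.\<close>

primrec traj :: "'a::ab_group_add pmf \<Rightarrow> nat \<Rightarrow> 'a \<Rightarrow> 'a list pmf" where
  "traj s 0 v = return_pmf [v]"
| "traj s (Suc N) v = bind_pmf s (\<lambda>x. map_pmf ((#) v) (traj s N (v + x)))"

primrec walk :: "'a::ab_group_add pmf \<Rightarrow> nat \<Rightarrow> 'a \<Rightarrow> 'a pmf" where
  "walk s 0 v = return_pmf v"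
| "walk s (Suc N) v = bind_pmf s (\<lambda>x. walk s N (v + x))"

lemma hd_traj: "xs \<in> set_pmf (traj s N v) \<Longrightarrow> xs \<noteq> [] \<and> hd xs = v"
  by (cases N) auto

lemma length_traj: "xs \<in> set_pmf (traj s N v) \<Longrightarrow> length xs = Suc N"
  by (induction N arbitrary: v xs) auto

text \<open>The recursion grows at the front, so shortening at the end takes an induction;
  \<open>butlast\<close> passes under the new head since the remaining list is nonempty.\<close>

lemma map_butlast_traj: "map_pmf butlast (traj s (Suc N) v) = traj s N v"
proof (induction N arbitrary: v)
  case 0
  then show ?case by (simp add: map_bind_pmf map_pmf_comp)
next
  case (Suc N)
  have IH: "map_pmf (\<lambda>xs. v # butlast xs) (traj s (Suc N) w) = map_pmf ((#) v) (traj s N w)" for w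
    using arg_cong[OF Suc.IH[of w], of "map_pmf ((#) v)"] by (simp only: map_pmf_comp)
  have "map_pmf butlast (traj s (Suc (Suc N)) v)
      = bind_pmf s (\<lambda>x. map_pmf (\<lambda>xs. butlast (v # xs)) (traj s (Suc N) (v + x)))"
    by (simp add: map_bind_pmf map_pmf_comp del: butlast.simps)
  also have "\<dots> = bind_pmf s (\<lambda>x. map_pmf (\<lambda>xs. v # butlast xs) (traj s (Suc N) (v + x)))"
    by (intro bind_pmf_cong refl map_pmf_cong) (auto dest: hd_traj)
  also have "\<dots> = traj s (Suc N) v"
    unfolding IH by simp
  finally show ?case .
qed

text \<open>The Markov property at the fixed time \<open>N\<close>: what follows is a fresh
  trajectory from the position at that time.\<close>

lemma map_drop_traj: "map_pmf (drop N) (traj s (N + k) v) = bind_pmf (walk s N v) (traj s k)"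
proof (induction N arbitrary: v)
  case (Suc N)
  then show ?case
    by (simp add: map_bind_pmf map_pmf_comp bind_assoc_pmf)
qed (simp add: bind_return_pmf)

lemma traj_translate: "traj s N (w + v) = map_pmf (map ((+) w)) (traj s N v)"
  by (induction N arbitrary: v) (simp_all add: map_bind_pmf map_pmf_comp add.assoc)

section \<open>Intersection probabilities and their superharmonicity\<close>

definition hit_upto :: "'a::ab_group_add pmf \<Rightarrow> nat \<Rightarrow> nat \<Rightarrow> 'a \<Rightarrow> 'a \<Rightarrow> ennreal" where
  "hit_upto s N N' v v' =
     emeasure (pair_pmf (traj s N v) (traj s N' v')) {(xs, ys). set xs \<inter> set ys \<noteq> {}}"

text \<open>By continuity from below, the probability that the full trajectories share a vertex, at
  possibly different times.\<close>

definition hit :: "'a::ab_group_add pmf \<Rightarrow> 'a \<Rightarrow> 'a \<Rightarrow> ennreal" where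
  "hit s v v' = (SUP N. hit_upto s N N v v')"

lemma hit_upto_commute: "hit_upto s N N' v v' = hit_upto s N' N v' v"
  unfolding hit_upto_def
  by (subst pair_commute_pmf) (auto simp: vimage_def case_prod_beta' Int_commute intro!: arg_cong2[where f = emeasure])

lemma hit_commute: "hit s v v' = hit s v' v"
  unfolding hit_def by (subst hit_upto_commute) (rule refl)

text \<open>The two horizons are coupled through \<open>butlast\<close>: shortening a trajectory can
  only lose vertices.\<close>

lemma hit_upto_mono_Suc: "hit_upto s N N' v v' \<le> hit_upto s (Suc N) N' v v'"
proof -
  have "hit_upto s N N' v v' = emeasure (pair_pmf (map_pmf butlast (traj s (Suc N) v)) (map_pmf id (traj s N' v')))
      {(xs, ys). set xs \<inter> set ys \<noteq> {}}"
    unfolding hit_upto_def by (simp add: map_butlast_traj del: traj.simps)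
  also have "\<dots> \<le> hit_upto s (Suc N) N' v v'"
    unfolding hit_upto_def map_pair[symmetric] emeasure_map_pmf
    by (rule emeasure_mono) (auto dest: in_set_butlastD)
  finally show ?thesis .
qed

lemma hit_upto_mono: "N \<le> K \<Longrightarrow> N' \<le> K' \<Longrightarrow> hit_upto s N N' v v' \<le> hit_upto s K K' v v'"
proof -
  have 1: "N \<le> K \<Longrightarrow> hit_upto s N N' v v' \<le> hit_upto s K N' v v'" for N K N' v v'
    by (rule lift_Suc_mono_le[where f = "\<lambda>N. hit_upto s N N' v v'"]) (rule hit_upto_mono_Suc)
  assume "N \<le> K" "N' \<le> K'"
  then have "hit_upto s N N' v v' \<le> hit_upto s K N' v v'" "hit_upto s N' K v' v \<le> hit_upto s K' K v' v"
    by (auto intro: 1)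
  then show ?thesis by (simp add: hit_upto_commute[of s _ K])
qed

text \<open>Prepending the start \<open>v\<close> keeps all intersections and may add one at
  \<open>v\<close> itself, whence an inequality. Separate horizons let one walk move while the other
  rests.\<close>

lemma hit_upto_step:
  fixes s :: "'a::ab_group_add pmf"
  shows "(\<integral>\<^sup>+x. hit_upto s N N' (v + x) v' \<partial>s) \<le> hit_upto s (Suc N) N' v v'"
proof -
  have "hit_upto s N N' (v + x) v'
      \<le> emeasure (pair_pmf (map_pmf ((#) v) (traj s N (v + x))) (map_pmf id (traj s N' v')))
          {(xs, ys). set xs \<inter> set ys \<noteq> {}}" for x
    unfolding hit_upto_def map_pair[symmetric] emeasure_map_pmf
    by (rule emeasure_mono) auto
  then have "(\<integral>\<^sup>+x. hit_upto s N N' (v + x) v' \<partial>s)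
      \<le> (\<integral>\<^sup>+x. emeasure (pair_pmf (map_pmf ((#) v) (traj s N (v + x))) (traj s N' v'))
          {(xs, ys). set xs \<inter> set ys \<noteq> {}} \<partial>s)"
    by (intro nn_integral_mono) simp
  also have "\<dots> = hit_upto s (Suc N) N' v v'"
    \<comment> \<open>A trivial bind over \<open>()\<close> puts the resting trajectory into the
      shape of \<open>pair_bind_pmf\<close>.\<close>
    using pair_bind_pmf[of s "\<lambda>x. map_pmf ((#) v) (traj s N (v + x))" "return_pmf ()" "\<lambda>_. traj s N' v'"]
    by (simp add: hit_upto_def bind_return_pmf)
  finally show ?thesis .
qed

text \<open>The one-step inequality survives monotone convergence, since the extra unit of horizon
  disappears in the supremum.\<close>

lemma hit_superharmonic:
  fixes s :: "'a::ab_group_add pmf"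
  shows "(\<integral>\<^sup>+x. hit s (v + x) v' \<partial>s) \<le> hit s v v'"
proof -
  have "(\<integral>\<^sup>+x. hit s (v + x) v' \<partial>s) = (SUP N. \<integral>\<^sup>+x. hit_upto s N N (v + x) v' \<partial>s)"
    unfolding hit_def
    by (rule nn_integral_monotone_convergence_SUP)
      (auto intro!: incseq_SucI le_funI hit_upto_mono)
  also have "\<dots> \<le> hit s v v'"
    unfolding hit_def
  proof (rule SUP_mono)
    fix N
    have "(\<integral>\<^sup>+x. hit_upto s N N (v + x) v' \<partial>s) \<le> hit_upto s (Suc N) (Suc N) v v'"
      using hit_upto_step hit_upto_mono by (rule order_trans) auto
    then show "\<exists>m\<in>UNIV. (\<integral>\<^sup>+x. hit_upto s N N (v + x) v' \<partial>s) \<le> hit_upto s m m v v'"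
      by blast
  qed
  finally show ?thesis .
qed

lemma hit_le_1: "hit s v v' \<le> 1"
  unfolding hit_def hit_upto_def by (intro SUP_least measure_pmf.emeasure_le_1)

lemma hit_self: "hit s v v = 1"
proof (rule antisym[OF hit_le_1])
  have "1 = hit_upto s 0 0 v v" by (simp add: hit_upto_def)
  also have "\<dots> \<le> hit s v v" unfolding hit_def by (rule SUP_upper) simp
  finally show "1 \<le> hit s v v" .
qed

lemma hit_translate: "hit s (w + v) (w + v') = hit s v v'"
proof -
  have "hit_upto s N N (w + v) (w + v') = hit_upto s N N v v'" for N
  proof -
    have "((+) w ` A) \<inter> ((+) w ` B) = {} \<longleftrightarrow> A \<inter> B = {}" for A B :: "'a set"
      by auto
    then show ?thesis
      unfolding hit_upto_def traj_translate map_pair[symmetric] emeasure_map_pmf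
      by (simp add: vimage_def case_prod_beta')
  qed
  then show ?thesis by (simp add: hit_def)
qed

section \<open>The walk at its first visits to new levels\<close>

definition step :: "real \<Rightarrow> vertex pmf" where
  "step lam = embed_pmf (network_step_prob lattice_adj (Gamma2_conductance lam) (0, 0, 0))"

text \<open>The factor \<open>exp (lam * n)\<close> common to all conductances at a vertex of level
  \<open>n\<close> cancels in the transition probabilities.\<close>

lemma network_step_prob_translate:
  "network_step_prob lattice_adj (Gamma2_conductance lam) x y
     = network_step_prob lattice_adj (Gamma2_conductance lam) (0, 0, 0) (y - x)"
proof -
  obtain n a b n' a' b' where xy: "x = (n, a, b)" "y = (n', a', b')"
    by (cases x; cases y) auto
  show ?thesis
    by (auto simp: xy Gamma2_step_prob minus_prod_def abs_minus_commute)
qed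

lemma neighbours_origin:
  "{z. lattice_adj (0, 0, 0) z} = {(1, 0, 0), (-1, 0, 0), (0, 1, 0), (0, -1, 0), (0, 0, 1), (0, 0, -1)}"
  using lattice_neighbours[of 0 0 0] by simp

text \<open>The six masses are nonnegative and add up to 1, so \<open>embed_pmf\<close> returns a
  law with exactly these masses.\<close>

lemma pmf_step: "pmf (step lam) z = (if z = (1, 0, 0) then exp lam / (5 + exp lam)
    else if lattice_adj (0, 0, 0) z then 1 / (5 + exp lam) else 0)" (is "_ = ?f z")
  and pmf_step_eq: "network_step_prob lattice_adj (Gamma2_conductance lam) (0, 0, 0) z = pmf (step lam) z"
proof -
  have f: "network_step_prob lattice_adj (Gamma2_conductance lam) (0, 0, 0) = ?f"
    using Gamma2_step_prob[of lam 0 0 0] by (intro ext) simp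
  let ?A = "{z. lattice_adj (0, 0, 0) z}"
  have pos: "0 < 5 + exp lam"
    using exp_gt_zero[of lam] by linarith
  then have nn: "0 \<le> ?f z" for z
    by auto
  have "(\<integral>\<^sup>+z. ennreal (?f z) \<partial>count_space UNIV) = (\<Sum>z\<in>?A. ennreal (?f z))"
  proof (rule nn_integral_count_space')
    show "finite ?A" by (simp only: neighbours_origin finite.intros)
    fix z assume "z \<notin> ?A"
    moreover have "(1, 0, 0) \<in> ?A" by simp
    ultimately have "z \<noteq> (1, 0, 0)" "\<not> lattice_adj (0, 0, 0) z" by blast+
    then show "ennreal (?f z) = 0" by (simp del: lattice_adj.simps)
  qed simp
  also have "\<dots> = ennreal (\<Sum>z\<in>?A. ?f z)"
    using nn by (intro sum_ennreal)
  also have "(\<Sum>z\<in>?A. ?f z) = (exp lam + 5) / (5 + exp lam)"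
    unfolding neighbours_origin by (simp add: add_divide_distrib)
  also have "\<dots> = 1"
    using pos by simp
  finally have "(\<integral>\<^sup>+z. ennreal (?f z) \<partial>count_space UNIV) = 1" by simp
  with nn show "pmf (step lam) z = ?f z"
    unfolding step_def f by (rule pmf_embed_pmf)
  then show "network_step_prob lattice_adj (Gamma2_conductance lam) (0, 0, 0) z = pmf (step lam) z"
    by (simp only: f)
qed

lemma set_pmf_step:
  "set_pmf (step lam) = {(1, 0, 0), (-1, 0, 0), (0, 1, 0), (0, -1, 0), (0, 0, 1), (0, 0, -1)}"
proof -
  have "5 + exp lam \<noteq> 0" using exp_gt_zero[of lam] by linarith
  then have "set_pmf (step lam) = {z. lattice_adj (0, 0, 0) z}"
    by (auto simp: set_pmf_eq pmf_step)
  then show ?thesis by (simp only: neighbours_origin)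
qed

text \<open>Nonnegativity is asked for on the six steps only, since the functions integrated below
  involve 1 minus the level, which is negative higher up.\<close>

lemma nn_integral_step:
  assumes "\<And>x. x \<in> set_pmf (step lam) \<Longrightarrow> 0 \<le> f x"
  shows "(\<integral>\<^sup>+x. ennreal (f x) \<partial>step lam) =
    ennreal ((exp lam * f (1, 0, 0) + f (-1, 0, 0) + f (0, 1, 0) + f (0, -1, 0) + f (0, 0, 1) + f (0, 0, -1))
      / (5 + exp lam))"
proof -
  have "(\<integral>\<^sup>+x. ennreal (f x) \<partial>step lam) = (\<Sum>x\<in>set_pmf (step lam). ennreal (f x * pmf (step lam) x))"
    by (subst nn_integral_measure_pmf_finite) (auto simp: set_pmf_step ennreal_mult'')
  also have "\<dots> = ennreal (\<Sum>x\<in>set_pmf (step lam). f x * pmf (step lam) x)"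
    using assms by (intro sum_ennreal) auto
  also have "(\<Sum>x\<in>set_pmf (step lam). f x * pmf (step lam) x) =
      (exp lam * f (1, 0, 0) + f (-1, 0, 0) + f (0, 1, 0) + f (0, -1, 0) + f (0, 0, 1) + f (0, 0, -1)) / (5 + exp lam)"
    by (simp add: set_pmf_step pmf_step add_divide_distrib mult.commute)
  finally show ?thesis .
qed

section \<open>The walk stopped at level 1\<close>

primrec stopped :: "real \<Rightarrow> nat \<Rightarrow> vertex pmf" where
  "stopped lam 0 = return_pmf 0"
| "stopped lam (Suc N) = bind_pmf (stopped lam N)
     (\<lambda>a. if fst a \<ge> 1 then return_pmf a else map_pmf ((+) a) (step lam))"

text \<open>A step raises the level by at most one and the walk is frozen from level 1 on, so there
  is no overshoot.\<close>

lemma stopped_level_le: "a \<in> set_pmf (stopped lam N) \<Longrightarrow> fst a \<le> 1"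
  by (induction N arbitrary: a) (auto simp: set_pmf_step split: if_splits)

text \<open>Optional stopping at a bounded time: a frozen walk contributes equality, and a moving
  one is at a level at most 0, where the hypothesis applies.\<close>

lemma stopped_supermartingale:
  fixes F :: "vertex \<Rightarrow> ennreal"
  assumes "\<And>a. fst a \<le> 0 \<Longrightarrow> (\<integral>\<^sup>+x. F (a + x) \<partial>step lam) \<le> F a"
  shows "(\<integral>\<^sup>+a. F a \<partial>stopped lam N) \<le> F 0"
proof (induction N)
  case (Suc N)
  have "(\<integral>\<^sup>+a. F a \<partial>stopped lam (Suc N)) \<le> (\<integral>\<^sup>+a. F a \<partial>stopped lam N)"
    unfolding stopped.simps nn_integral_bind_pmf
    by (intro nn_integral_mono) (auto intro!: assms)
  with Suc show ?case by simp
qed simp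

text \<open>The Lyapunov function 1 minus the level starts at 1 and loses \<open>d\<close> in mean
  at each step before stopping. Hence the expected stopping time is at most \<open>1 / d\<close>,
  and the walk is still moving at time \<open>N\<close> with probability at most
  \<open>1 / (d * N)\<close>.\<close>

lemma stopped_mass:
  assumes "lam > 0"
  shows "(SUP N. emeasure (stopped lam N) {a. fst a = 1}) = 1"
proof -
  \<comment> \<open>The mean upward displacement of one step.\<close>
  define d where "d = (exp lam - 1) / (5 + exp lam)"
  have pos: "exp lam > 1" using assms by simp
  then have K: "exp lam + 5 \<noteq> 0" "5 + exp lam \<noteq> 0" "5 + exp lam > 0" by linarith+
  with pos have d: "d > 0" by (simp add: d_def)
  define B :: "vertex set" where "B = {a. fst a \<le> 0}"
  define \<psi> where "\<psi> a = ennreal (1 - of_int (fst a))" for a :: vertex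
  have drift: "(\<integral>\<^sup>+x. \<psi> (a + x) \<partial>step lam) + ennreal d = \<psi> a" if "fst a \<le> 0" for a
  proof -
    have "(\<integral>\<^sup>+x. \<psi> (a + x) \<partial>step lam) = ennreal (1 - of_int (fst a) - d)"
      unfolding \<psi>_def
    proof (subst nn_integral_step)
      show "0 \<le> 1 - real_of_int (fst (a + x))" if "x \<in> set_pmf (step lam)" for x
        using that \<open>fst a \<le> 0\<close> by (auto simp: set_pmf_step)
      have "exp lam * (1 - real_of_int (fst (a + (1, 0, 0)))) + (1 - real_of_int (fst (a + (-1, 0, 0))))
          + (1 - real_of_int (fst (a + (0, 1, 0)))) + (1 - real_of_int (fst (a + (0, -1, 0))))
          + (1 - real_of_int (fst (a + (0, 0, 1)))) + (1 - real_of_int (fst (a + (0, 0, -1))))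
          = (1 - real_of_int (fst a)) * (5 + exp lam) - (exp lam - 1)"
        by (simp add: algebra_simps)
      then show "ennreal ((exp lam * (1 - real_of_int (fst (a + (1, 0, 0)))) + (1 - real_of_int (fst (a + (-1, 0, 0))))
          + (1 - real_of_int (fst (a + (0, 1, 0)))) + (1 - real_of_int (fst (a + (0, -1, 0))))
          + (1 - real_of_int (fst (a + (0, 0, 1)))) + (1 - real_of_int (fst (a + (0, 0, -1))))) / (5 + exp lam))
          = ennreal (1 - real_of_int (fst a) - d)"
        by (simp only: d_def diff_divide_distrib[of _ _ "5 + exp lam"] nonzero_mult_div_cancel_right[OF K(2)])
    qed
    \<comment> \<open>At levels at most 0 this keeps 1 minus the level minus \<open>d\<close>
      nonnegative, so that \<open>ennreal\<close> truncates nothing.\<close>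
    moreover have "d \<le> 1" using K(3) by (simp add: d_def divide_le_eq)
    then have "0 \<le> 1 - of_int (fst a) - d" using that by linarith
    ultimately show ?thesis
      using d by (simp add: \<psi>_def flip: ennreal_plus)
  qed
  have time: "(\<integral>\<^sup>+a. \<psi> a \<partial>stopped lam N) + (\<Sum>k<N. ennreal d * emeasure (stopped lam k) B) \<le> 1" for N
  proof (induction N)
    case (Suc N)
    have "(\<integral>\<^sup>+a. \<psi> a \<partial>stopped lam (Suc N)) + ennreal d * emeasure (stopped lam N) B
        = (\<integral>\<^sup>+a. (\<integral>\<^sup>+b. \<psi> b \<partial>(if fst a \<ge> 1 then return_pmf a else map_pmf ((+) a) (step lam)))
            + ennreal d * indicator B a \<partial>stopped lam N)"
      by (simp add: nn_integral_add nn_integral_cmult)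
    also have "\<dots> \<le> (\<integral>\<^sup>+a. \<psi> a \<partial>stopped lam N)"
      by (intro nn_integral_mono) (auto simp: B_def drift)
    finally have "(\<integral>\<^sup>+a. \<psi> a \<partial>stopped lam (Suc N)) + ennreal d * emeasure (stopped lam N) B
        + (\<Sum>k<N. ennreal d * emeasure (stopped lam k) B) \<le> 1"
      using Suc by (meson add_right_mono order_trans)
    then show ?case by (simp only: sum.lessThan_Suc add_ac)
  qed (simp add: \<psi>_def)
  \<comment> \<open>A walk that has left \<open>B\<close> is frozen and never returns, so each
    summand in \<open>time\<close> is at least its value at \<open>N\<close>.\<close>
  have anti: "emeasure (stopped lam (Suc k)) B \<le> emeasure (stopped lam k) B" for k
    unfolding stopped.simps emeasure_bind_pmf
    by (subst nn_integral_indicator[symmetric], simp, intro nn_integral_mono)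
      (auto simp: B_def indicator_def measure_pmf.emeasure_le_1)
  have anti': "emeasure (stopped lam N) B \<le> emeasure (stopped lam k) B" if "k \<le> N" for k N
    by (rule lift_Suc_antimono_le[where f = "\<lambda>k. emeasure (stopped lam k) B"]) (use anti that in auto)
  have bound: "measure (stopped lam N) B \<le> 1 / (d * real N)" if "N > 0" for N
  proof -
    have "of_nat N * (ennreal d * emeasure (stopped lam N) B) \<le> (\<Sum>k<N. ennreal d * emeasure (stopped lam k) B)"
      using sum_bounded_below[of "{..<N}" "ennreal d * emeasure (stopped lam N) B"
          "\<lambda>k. ennreal d * emeasure (stopped lam k) B"] anti'
      by (simp add: mult_left_mono)
    also have "\<dots> \<le> 1"
      using time[of N] by (rule order_trans[rotated]) simp
    finally have "real N * (d * measure (stopped lam N) B) \<le> 1"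
      using d by (simp add: measure_pmf.emeasure_eq_measure ennreal_of_nat_eq_real_of_nat ennreal_mult''[symmetric]
          ennreal_mult'[symmetric] flip: ennreal_1)
    then show ?thesis using d that by (simp add: field_simps)
  qed
  have compl: "emeasure (stopped lam N) {a. fst a = 1} = ennreal (1 - measure (stopped lam N) B)" for N
  proof -
    have "measure (stopped lam N) {a. fst a = 1} = measure (stopped lam N) (- B)"
      by (intro measure_pmf.finite_measure_eq_AE)
        (auto simp: AE_measure_pmf_iff B_def dest: stopped_level_le)
    also have "\<dots> = 1 - measure (stopped lam N) B"
      using measure_pmf.prob_compl[of B "stopped lam N"] by (simp add: Compl_eq_Diff_UNIV)
    finally show ?thesis by (simp add: measure_pmf.emeasure_eq_measure)
  qed
  show ?thesis
  proof (rule antisym)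
    show "(SUP N. emeasure (stopped lam N) {a. fst a = 1}) \<le> 1"
      by (intro SUP_least measure_pmf.emeasure_le_1)
    have "(\<lambda>N. 1 - 1 / (d * real N)) \<longlonglongrightarrow> 1 - 0"
      using d by (intro tendsto_intros tendsto_divide_0[OF tendsto_const]
        filterlim_at_top_imp_at_infinity filterlim_tendsto_pos_mult_at_top[OF tendsto_const] filterlim_real_sequentially)
    then have "(\<lambda>N. ennreal (1 - 1 / (d * real N))) \<longlonglongrightarrow> 1"
      using tendsto_ennrealI by fastforce
    then show "1 \<le> (SUP N. emeasure (stopped lam N) {a. fst a = 1})"
    proof (rule LIMSEQ_le_const2)
      have "ennreal (1 - 1 / (d * real N)) \<le> emeasure (stopped lam N) {a. fst a = 1}" if "N \<ge> 1" for N
        unfolding compl using bound[of N] that by (intro ennreal_leI) simp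
      then show "\<exists>N0. \<forall>N\<ge>N0. ennreal (1 - 1 / (d * real N)) \<le> (SUP N. emeasure (stopped lam N) {a. fst a = 1})"
        by (meson SUP_upper UNIV_I order_trans)
    qed
  qed
qed

text \<open>The law of the displacement at the first visit to level 1, obtained as the increasing limit
  of the laws of the stopped walk restricted to that level; \<open>nn_integral_level_law\<close> below
  shows that the choice is not from an empty predicate.\<close>

definition level_law :: "real \<Rightarrow> vertex pmf" where
  "level_law lam = (SOME g. \<forall>F. (\<integral>\<^sup>+x. F x \<partial>measure_pmf g)
     = (SUP N. \<integral>\<^sup>+x. F x * indicator {a. fst a = 1} x \<partial>stopped lam N))"

text \<open>Points of level 1 only gain mass because the walk is frozen there, and
  \<open>stopped_mass\<close> gives total mass 1 in the limit.\<close>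

lemma nn_integral_level_law:
  fixes F :: "vertex \<Rightarrow> ennreal"
  assumes "lam > 0"
  shows "(\<integral>\<^sup>+x. F x \<partial>level_law lam) = (SUP N. \<integral>\<^sup>+x. F x * indicator {a. fst a = 1} x \<partial>stopped lam N)"
proof -
  have mono: "pmf (stopped lam N) x \<le> pmf (stopped lam (Suc N)) x" if "x \<in> {a. fst a = 1}" for N x
  proof -
    have "emeasure (stopped lam N) {x} \<le> emeasure (stopped lam (Suc N)) {x}"
      unfolding stopped.simps emeasure_bind_pmf using that
      by (subst nn_integral_indicator[symmetric], simp, intro nn_integral_mono) (auto simp: indicator_def)
    then show ?thesis by (simp add: emeasure_pmf_single)
  qed
  obtain g :: "vertex pmf" where
    "\<And>F. (\<integral>\<^sup>+x. F x \<partial>g) = (SUP N. \<integral>\<^sup>+x. F x * indicator {a. fst a = 1} x \<partial>stopped lam N)"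
    using pmf_monotone_limit[OF mono stopped_mass[OF assms]] by blast
  then have "\<exists>g::vertex pmf. \<forall>F. (\<integral>\<^sup>+x. F x \<partial>g)
      = (SUP N. \<integral>\<^sup>+x. F x * indicator {a. fst a = 1} x \<partial>stopped lam N)"
    by blast
  from someI_ex[OF this] show ?thesis unfolding level_law_def by blast
qed

text \<open>Optional stopping at the first visit to level 1: discarding the walks not yet stopped
  only lowers the integral of a nonnegative function.\<close>

lemma level_law_supermartingale:
  fixes F :: "vertex \<Rightarrow> ennreal"
  assumes "lam > 0" and "\<And>a. fst a \<le> 0 \<Longrightarrow> (\<integral>\<^sup>+x. F (a + x) \<partial>step lam) \<le> F a"
  shows "(\<integral>\<^sup>+x. F x \<partial>level_law lam) \<le> F 0"
  unfolding nn_integral_level_law[OF assms(1)]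
proof (rule SUP_least)
  fix N
  have "(\<integral>\<^sup>+x. F x * indicator {a. fst a = 1} x \<partial>stopped lam N) \<le> (\<integral>\<^sup>+x. F x \<partial>stopped lam N)"
    by (intro nn_integral_mono) (simp add: indicator_def)
  then show "(\<integral>\<^sup>+x. F x * indicator {a. fst a = 1} x \<partial>stopped lam N) \<le> F 0"
    using stopped_supermartingale[of lam F N, OF assms(2)] by (rule order_trans) assumption
qed

text \<open>A point of level 1 is reached with positive probability by moving inside level 0 and
  then stepping up once. Full support lets the one-step conclusion of
  \<open>recurrent_meeting\<close> cover all starts at a common level.\<close>

lemma set_pmf_level_law:
  assumes "lam > 0"
  shows "set_pmf (level_law lam) = {a. fst a = 1}"
proof -
  have pmf: "ennreal (pmf (level_law lam) y)
      = (SUP N. \<integral>\<^sup>+x. indicator {y} x * indicator {a. fst a = 1} x \<partial>stopped lam N)" for y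
    using nn_integral_level_law[OF assms, of "indicator {y}"] by (simp add: emeasure_pmf_single)
  have "y \<notin> set_pmf (level_law lam)" if "fst y \<noteq> 1" for y
  proof -
    have "(\<integral>\<^sup>+x. indicator {y} x * indicator {a. fst a = 1} x \<partial>stopped lam N) = 0" for N
      using that by (intro nn_integral_zero') (auto simp: indicator_def)
    then have "ennreal (pmf (level_law lam) y) = 0" unfolding pmf by simp
    then show ?thesis by (simp add: set_pmf_iff)
  qed
  moreover have "y \<in> set_pmf (level_law lam)" if y: "fst y = 1" for y
  proof -
    have sideways: "\<exists>N. (0, a, b) \<in> set_pmf (stopped lam N)" for a b :: int
    proof -
      define R where "R v \<longleftrightarrow> (\<exists>N. v \<in> set_pmf (stopped lam N))" for v :: vertex
      have R_step: "R (v + x)" if R: "R v" "fst v < 1" "x \<in> set_pmf (step lam)" for v x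
      proof -
        obtain N where "v \<in> set_pmf (stopped lam N)" using R by (auto simp: R_def)
        then have "v + x \<in> set_pmf (stopped lam (Suc N))" using R by (auto intro!: bexI[of _ v])
        then show ?thesis unfolding R_def by blast
      qed
      have R_00: "R (0, 0, 0)" unfolding R_def by (rule exI[of _ 0]) (simp add: zero_prod_def)
      have R_a0: "R (0, a, 0)"
      proof (induction a rule: int_induct[where k = 0])
        case (step1 i)
        from R_step[OF step1(2), of "(0, 1, 0)"] show ?case by (simp add: set_pmf_step)
      next
        case (step2 i)
        from R_step[OF step2(2), of "(0, -1, 0)"] show ?case by (simp add: set_pmf_step)
      qed (rule R_00)
      have "R (0, a, b)"
      proof (induction b rule: int_induct[where k = 0])
        case (step1 i)
        from R_step[OF step1(2), of "(0, 0, 1)"] show ?case by (simp add: set_pmf_step)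
      next
        case (step2 i)
        from R_step[OF step2(2), of "(0, 0, -1)"] show ?case by (simp add: set_pmf_step)
      qed (rule R_a0)
      then show ?thesis by (simp add: R_def)
    qed
    obtain a b where y_eq: "y = (1, a, b)" using y by (cases y) auto
    obtain N where "(0, a, b) \<in> set_pmf (stopped lam N)" using sideways by blast
    then have mem: "y \<in> set_pmf (stopped lam (Suc N))"
      by (auto simp: y_eq set_pmf_step intro!: bexI[of _ "(0, a, b)"])
    have "(\<integral>\<^sup>+x. indicator {y} x * indicator {a. fst a = 1} x \<partial>stopped lam (Suc N))
        = (\<integral>\<^sup>+x. indicator {y} x \<partial>stopped lam (Suc N))"
      using y by (intro nn_integral_cong) (auto simp: indicator_def)
    also have "\<dots> = ennreal (pmf (stopped lam (Suc N)) y)"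
      by (simp add: emeasure_pmf_single del: stopped.simps)
    also have "\<dots> > 0"
      using mem by (simp add: pmf_positive del: stopped.simps)
    also have "(\<integral>\<^sup>+x. indicator {y} x * indicator {a. fst a = 1} x \<partial>stopped lam (Suc N))
        \<le> ennreal (pmf (level_law lam) y)"
      unfolding pmf by (rule SUP_upper) simp
    finally show ?thesis by (simp add: set_pmf_iff)
  qed
  ultimately show ?thesis by blast
qed

section \<open>Second moments of the horizontal displacement\<close>

definition horizontal_sq :: "vertex \<Rightarrow> real" where
  "horizontal_sq a = (of_int (fst (snd a)))\<^sup>2 + (of_int (snd (snd a)))\<^sup>2"

lemma horizontal_sq_nonneg: "0 \<le> horizontal_sq a"
  by (simp add: horizontal_sq_def)

text \<open>The correction in \<open>f\<close> vanishes at level 1, so the supermartingale bound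
  concerns the horizontal part alone. Opposite horizontal steps cancel the linear terms, and an
  arbitrary origin \<open>x0\<close> lets the bound iterate without a separate computation of the
  mean.\<close>

lemma level_law_second_moment:
  assumes "lam > 0"
  shows "(\<integral>\<^sup>+x. ennreal (horizontal_sq (x0 + x)) \<partial>level_law lam) \<le> ennreal (horizontal_sq x0 + 4 / (exp lam - 1))"
proof -
  define c where "c = 4 / (exp lam - 1)"
  have e: "exp lam > 1" using assms by simp
  then have "c > 0" by (simp add: c_def)
  have "exp lam - 1 \<noteq> 0" using e by linarith
  from iffD1[OF nonzero_eq_divide_eq[OF this] c_def] have "c * (exp lam - 1) = 4" .
  note c = \<open>c > 0\<close> this
  have K: "5 + exp lam \<noteq> 0" using e by linarith
  define f where "f a = horizontal_sq (x0 + a) + c * (1 - of_int (fst a))" for a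
  \<comment> \<open>\<open>c\<close> is chosen so that the growth of the squared horizontal displacement is
    compensated exactly by the upward drift; \<open>f\<close> is nonnegative as long as the level is at most 1\<close>
  have "(\<integral>\<^sup>+x. ennreal (f (a + x)) \<partial>step lam) \<le> ennreal (f a)" if a: "fst a \<le> 0" for a
  proof (subst nn_integral_step)
    show "0 \<le> f (a + x)" if "x \<in> set_pmf (step lam)" for x
      unfolding f_def using that a c(1)
      by (intro add_nonneg_nonneg horizontal_sq_nonneg mult_nonneg_nonneg) (auto simp: set_pmf_step)
    have "exp lam * f (a + (1, 0, 0)) + f (a + (-1, 0, 0)) + f (a + (0, 1, 0)) + f (a + (0, -1, 0))
        + f (a + (0, 0, 1)) + f (a + (0, 0, -1)) = f a * (5 + exp lam) + (4 - c * (exp lam - 1))"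
      by (simp add: f_def horizontal_sq_def power2_eq_square algebra_simps)
    then show "ennreal ((exp lam * f (a + (1, 0, 0)) + f (a + (-1, 0, 0)) + f (a + (0, 1, 0)) + f (a + (0, -1, 0))
        + f (a + (0, 0, 1)) + f (a + (0, 0, -1))) / (5 + exp lam)) \<le> ennreal (f a)"
      using K by (simp only: c(2)) simp
  qed
  then have "(\<integral>\<^sup>+x. ennreal (f x) \<partial>level_law lam) \<le> ennreal (f 0)"
    by (rule level_law_supermartingale[OF assms])
  moreover have "(\<integral>\<^sup>+x. ennreal (f x) \<partial>level_law lam) = (\<integral>\<^sup>+x. ennreal (horizontal_sq (x0 + x)) \<partial>level_law lam)"
    by (intro nn_integral_cong_AE) (simp add: AE_measure_pmf_iff set_pmf_level_law[OF assms] f_def)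
  ultimately show ?thesis by (simp add: f_def c_def)
qed

lemma conv_power_second_moment:
  assumes "lam > 0"
  shows "(\<integral>\<^sup>+x. ennreal (horizontal_sq x) \<partial>conv_power (level_law lam) n) \<le> ennreal (4 / (exp lam - 1) * real n)"
proof (induction n)
  case 0
  then show ?case by (simp add: horizontal_sq_def)
next
  case (Suc n)
  define c where "c = 4 / (exp lam - 1)"
  have c: "c \<ge> 0" using assms by (simp add: c_def)
  have "(\<integral>\<^sup>+x. ennreal (horizontal_sq x) \<partial>conv_power (level_law lam) (Suc n))
      = (\<integral>\<^sup>+x. \<integral>\<^sup>+y. ennreal (horizontal_sq (x + y)) \<partial>level_law lam \<partial>conv_power (level_law lam) n)"
    unfolding conv_power_Suc' by simp
  also have "\<dots> \<le> (\<integral>\<^sup>+x. ennreal (horizontal_sq x) + ennreal c \<partial>conv_power (level_law lam) n)"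
    using level_law_second_moment[OF assms] c
    by (intro nn_integral_mono) (simp add: horizontal_sq_nonneg c_def ennreal_plus)
  also have "\<dots> \<le> ennreal (c * real n) + ennreal c"
    using Suc by (subst nn_integral_add) (auto simp: c_def intro: add_right_mono)
  also have "\<dots> = ennreal (c * real (Suc n))"
    using c by (simp add: algebra_simps flip: ennreal_plus)
  finally show ?case by (simp only: c_def)
qed

section \<open>Divergence of the expected number of meetings\<close>

lemma conv_power_level:
  assumes "lam > 0"
  shows "a \<in> set_pmf (conv_power (level_law lam) n) \<Longrightarrow> fst a = int n"
  by (induction n arbitrary: a) (auto simp: set_pmf_level_law[OF assms])

lemma meet_level_law_ge:
  assumes "lam > 0"
  shows "\<exists>K>0. \<forall>n. ennreal (K * inverse (real (Suc n))) \<le> meet (level_law lam) n 0"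
proof -
  define c where "c = 4 / (exp lam - 1)"
  have c: "c > 0" using assms by (simp add: c_def)
  \<comment> \<open>The factor 4 comes from squaring the mass 1/2 of a box, and
    \<open>16 * c + 18\<close> bounds the number of its points per unit of
    \<open>Suc n\<close>.\<close>
  have main: "1 / (4 * (16 * c + 18)) * inverse (real (Suc n)) \<le> measure (pair_pmf (conv_power (level_law lam) n) (conv_power (level_law lam) n)) {(y, y'). y = y'}" for n
  proof -
    let ?X = "conv_power (level_law lam) n"
    \<comment> \<open>At least twice the second moment bound, so that Markov's inequality leaves at
      most 1/2 outside the box; \<open>Suc n\<close> keeps \<open>t\<close> positive for
      \<open>n = 0\<close>.\<close>
    define t where "t = 2 * c * real (Suc n)"
    have t: "t > 0" using c by (simp add: t_def)
    define r where "r = \<lceil>sqrt t\<rceil>"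
    have r: "sqrt t \<le> of_int r" "of_int r \<le> sqrt t + 1" unfolding r_def by linarith+
    have r0: "r > 0" using t r(1) real_sqrt_gt_zero[OF t] by linarith
    \<comment> \<open>After \<open>n\<close> steps the level is exactly \<open>n\<close>, so the box
      is two-dimensional and has only order \<open>n\<close> points.\<close>
    define B :: "vertex set" where "B = {int n} \<times> {-r..r} \<times> {-r..r}"
    have far: "t \<le> horizontal_sq a" if "fst a = int n" "a \<notin> B" for a
    proof -
      have "r \<le> \<bar>fst (snd a)\<bar> \<or> r \<le> \<bar>snd (snd a)\<bar>"
        using that unfolding B_def by (cases a) auto
      then obtain z where z: "z = fst (snd a) \<or> z = snd (snd a)" "r \<le> \<bar>z\<bar>" by blast
      have "t = (sqrt t)\<^sup>2" using t by simp
      also have "\<dots> \<le> \<bar>real_of_int z\<bar>\<^sup>2"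
        using t r(1) z(2) by (intro power_mono) (linarith, simp)
      also have "\<dots> \<le> horizontal_sq a"
        using z(1) by (auto simp: horizontal_sq_def)
      finally show ?thesis .
    qed
    have "ennreal t * emeasure ?X (- B) = (\<integral>\<^sup>+x. ennreal t * indicator (- B) x \<partial>?X)"
      by (simp add: nn_integral_cmult)
    also have "\<dots> \<le> (\<integral>\<^sup>+x. ennreal (horizontal_sq x) \<partial>?X)"
      by (intro nn_integral_mono_AE)
        (auto simp: AE_measure_pmf_iff indicator_def intro!: ennreal_leI far dest: conv_power_level[OF assms])
    also have "\<dots> \<le> ennreal (c * real n)"
      using conv_power_second_moment[OF assms] by (simp add: c_def)
    finally have "t * measure ?X (- B) \<le> c * real n"
      using t c by (simp add: measure_pmf.emeasure_eq_measure flip: ennreal_mult)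
    also have "\<dots> \<le> t * (1 / 2)" using c by (simp add: t_def)
    finally have "measure ?X (- B) \<le> 1 / 2"
      using t by (simp only: mult_le_cancel_left_pos)
    then have half: "1 / 2 \<le> measure ?X B"
      using measure_pmf.prob_compl[of B ?X] by (simp add: Compl_eq_Diff_UNIV)
    have "real (card B) = (2 * of_int r + 1)\<^sup>2"
      using r0 by (simp add: B_def card_cartesian_product power2_eq_square)
    also have "\<dots> \<le> (2 * sqrt t + 3)\<^sup>2"
      using r r0 by (intro power_mono) auto
    \<comment> \<open>Adding the second square cancels the term linear in
      \<open>sqrt t\<close>.\<close>
    also have "\<dots> \<le> (2 * sqrt t + 3)\<^sup>2 + (2 * sqrt t - 3)\<^sup>2"
      by simp
    also have "\<dots> = 8 * t + 18"
      using t by (simp add: power2_eq_square algebra_simps)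
    also have "\<dots> \<le> (16 * c + 18) * real (Suc n)"
      unfolding t_def by (simp add: algebra_simps)
    finally have card: "real (card B) \<le> (16 * c + 18) * real (Suc n)" .
    define m where "m = measure (pair_pmf ?X ?X) {(y, y'). y = y'}"
    have "(1 / 2)\<^sup>2 \<le> (measure ?X B)\<^sup>2"
      using half by (intro power_mono) auto
    also have "\<dots> \<le> real (card B) * m"
      unfolding m_def by (rule pair_pmf_diagonal_ge) (simp add: B_def)
    also have "\<dots> \<le> (16 * c + 18) * real (Suc n) * m"
      using card by (intro mult_right_mono) (simp_all add: m_def)
    finally have "1 / 4 \<le> m * ((16 * c + 18) * real (Suc n))"
      by (simp only: mult.commute power_one_over) simp
    moreover have "(16 * c + 18) * real (Suc n) > 0" using c by (intro mult_pos_pos) simp_all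
    ultimately have "1 / 4 / ((16 * c + 18) * real (Suc n)) \<le> m"
      by (simp only: pos_divide_le_eq)
    also have "1 / 4 / ((16 * c + 18) * real (Suc n)) = 1 / (4 * (16 * c + 18)) * inverse (real (Suc n))"
      by (simp only: divide_inverse inverse_mult_distrib mult_1_left mult.assoc)
    finally show ?thesis
      unfolding m_def .
  qed
  show ?thesis
  proof (intro exI[of _ "1 / (4 * (16 * c + 18))"] conjI allI)
    fix n
    show "ennreal (1 / (4 * (16 * c + 18)) * inverse (real (Suc n))) \<le> meet (level_law lam) n 0"
      unfolding meet_def measure_pmf.emeasure_eq_measure using main by (intro ennreal_leI) simp
  qed (use c in simp)
qed

lemma meet_level_law_diverges:
  assumes "lam > 0"
  shows "(\<Sum>n. meet (level_law lam) n 0) = \<infinity>"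
proof -
  obtain K where K: "K > 0" "\<And>n. ennreal (K * inverse (real (Suc n))) \<le> meet (level_law lam) n 0"
    using meet_level_law_ge[OF assms] by blast
  have "\<not> summable (\<lambda>n. inverse (real (Suc n)))"
    using not_summable_harmonic[where 'a = real] by (subst summable_Suc_iff)
  then have "\<not> summable (\<lambda>n. K * inverse (real (Suc n)))"
    using K(1) by (simp only: summable_cmult_iff) simp
  moreover have "summable (\<lambda>n. K * inverse (real (Suc n)))"
    if "(\<Sum>n. ennreal (K * inverse (real (Suc n)))) \<noteq> \<top>"
    by (rule summable_suminf_not_top[OF _ that]) (use K(1) in simp)
  ultimately have "(\<Sum>n. ennreal (K * inverse (real (Suc n)))) = \<top>"
    by blast
  moreover have "(\<Sum>n. ennreal (K * inverse (real (Suc n)))) \<le> (\<Sum>n. meet (level_law lam) n 0)"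
    by (intro suminf_le K(2)) auto
  ultimately show ?thesis by (simp only: infinity_ennreal_def top_unique)
qed

section \<open>Two walks intersect with probability 1\<close>

lemma level_law_hit_superharmonic:
  fixes v v' :: vertex
  assumes "lam > 0"
  shows "(\<integral>\<^sup>+y. hit (step lam) (v + y) v' \<partial>level_law lam) \<le> hit (step lam) v v'"
proof -
  have "(\<integral>\<^sup>+y. hit (step lam) (v + y) v' \<partial>level_law lam) \<le> hit (step lam) (v + 0) v'"
    by (rule level_law_supermartingale[OF assms]) (simp add: add.assoc[symmetric] hit_superharmonic)
  then show ?thesis by simp
qed

text \<open>This is \<open>recurrent_meeting\<close> for the walks observed at new levels;
  superharmonicity in both arguments, with translation and symmetry, supplies its hypothesis on
  \<open>h\<close>.\<close>

lemma hit_same_level: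
  assumes lam: "lam > 0" and lev: "fst v = fst v'"
  shows "hit (step lam) v v' = 1"
proof -
  define h where "h x = hit (step lam) x 0" for x :: vertex
  have "(\<integral>\<^sup>+y. \<integral>\<^sup>+y'. h (x + y - y') \<partial>level_law lam \<partial>level_law lam) \<le> h x" for x
  proof -
    \<comment> \<open>Subtracting \<open>y'\<close> from the first start amounts to moving the
      second one by \<open>y'\<close>.\<close>
    have "h (x + y - y') = hit (step lam) (0 + y') (x + y)" for y y'
      using hit_translate[of "step lam" y' "x + y - y'" 0]
      by (simp add: h_def hit_commute[of _ y'])
    then have "(\<integral>\<^sup>+y'. h (x + y - y') \<partial>level_law lam) \<le> hit (step lam) (x + y) 0" for y
      using level_law_hit_superharmonic[OF lam, of 0 "x + y"]
      by (simp only: hit_commute[of _ "x + y" 0])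
    then have "(\<integral>\<^sup>+y. \<integral>\<^sup>+y'. h (x + y - y') \<partial>level_law lam \<partial>level_law lam)
        \<le> (\<integral>\<^sup>+y. hit (step lam) (x + y) 0 \<partial>level_law lam)"
      by (intro nn_integral_mono)
    also have "\<dots> \<le> h x"
      unfolding h_def by (rule level_law_hit_superharmonic[OF lam])
    finally show ?thesis .
  qed
  \<comment> \<open>Raising both terms by one level puts them into the support and leaves their
    difference equal to \<open>v - v'\<close>.\<close>
  moreover have "v - v' + (1, 0, 0) \<in> set_pmf (level_law lam)" "(1, 0, 0) \<in> set_pmf (level_law lam)"
    using lev by (simp_all add: set_pmf_level_law[OF lam])
  ultimately have "h (v - v' + (1, 0, 0) - (1, 0, 0)) = 1"
    using recurrent_meeting[of h "level_law lam" "v - v' + (1, 0, 0)" "(1, 0, 0)"]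
      meet_level_law_diverges[OF lam] by (simp only: h_def hit_self hit_le_1)
  then show ?thesis
    using hit_translate[of "step lam" v' "v - v'" 0] by (simp add: h_def)
qed

text \<open>Averaging over the first visit to the next level lifts the lower walk by one; induction
  on the gap reduces to equal levels, and symmetry handles the other order.\<close>

lemma hit_eq_1:
  assumes lam: "lam > 0"
  shows "hit (step lam) v v' = 1"
proof -
  have lower: "hit (step lam) v v' = 1" if "fst v' = fst v + int k" for k v v'
    using that
  proof (induction k arbitrary: v)
    case 0
    then show ?case using hit_same_level[OF lam] by simp
  next
    case (Suc k)
    have "1 = (\<integral>\<^sup>+y. hit (step lam) (v + y) v' \<partial>level_law lam)"
    proof -
      have "(\<integral>\<^sup>+y. hit (step lam) (v + y) v' \<partial>level_law lam) = (\<integral>\<^sup>+y. 1 \<partial>level_law lam)"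
        using Suc.prems by (intro nn_integral_cong_AE)
          (auto simp: AE_measure_pmf_iff set_pmf_level_law[OF lam] intro!: Suc.IH)
      then show ?thesis by simp
    qed
    also have "\<dots> \<le> hit (step lam) v v'"
      by (rule level_law_hit_superharmonic[OF lam])
    finally show ?case using hit_le_1 antisym by blast
  qed
  show ?thesis
  proof (cases "fst v \<le> fst v'")
    case True
    then show ?thesis by (intro lower[where k = "nat (fst v' - fst v)"]) simp
  next
    case False
    then have "hit (step lam) v' v = 1" by (intro lower[where k = "nat (fst v - fst v')"]) simp
    then show ?thesis by (simp only: hit_commute[of _ v v'])
  qed
qed

section \<open>Transfer to network random walks\<close>

text \<open>Only one first increment leads from \<open>v\<close> to the second entry, so the
  integral keeps a single term. Indexing by a function \<open>x\<close> matches the cylinder events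
  in \<open>network_random_walk\<close>.\<close>

lemma pmf_traj:
  fixes x :: "nat \<Rightarrow> 'a::ab_group_add"
  shows "pmf (traj s n v) (map x [0..<Suc n]) = (if x 0 = v then \<Prod>i<n. pmf s (x (Suc i) - x i) else 0)"
proof (induction n arbitrary: v x)
  case 0
  then show ?case by (simp add: pmf_return)
next
  case (Suc n)
  let ?y = "\<lambda>i. x (Suc i)"
  have xs: "map x [0..<Suc (Suc n)] = x 0 # map ?y [0..<Suc n]"
    by (simp only: upt_conv_Cons[OF zero_less_Suc] map_Suc_upt[symmetric] list.map map_map o_def)
  show ?case
  proof (cases "x 0 = v")
    case True
    define C where "C = (\<Prod>i<n. pmf s (?y (Suc i) - ?y i))"
    have "ennreal (pmf (traj s (Suc n) v) (map x [0..<Suc (Suc n)]))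
        = (\<integral>\<^sup>+d. ennreal (pmf (traj s n (v + d)) (map ?y [0..<Suc n])) \<partial>measure_pmf s)"
      unfolding xs traj.simps ennreal_pmf_bind True
      by (subst pmf_map_inj') (auto simp: inj_on_def)
    also have "\<dots> = (\<integral>\<^sup>+d. ennreal C * indicator {x 1 - v} d \<partial>measure_pmf s)"
      unfolding Suc.IH C_def by (intro nn_integral_cong) (auto simp: indicator_def)
    also have "\<dots> = ennreal (C * pmf s (x 1 - v))"
      by (simp add: nn_integral_cmult emeasure_pmf_single ennreal_mult'' del: One_nat_def)
    finally have "pmf (traj s (Suc n) v) (map x [0..<Suc (Suc n)]) = C * pmf s (x 1 - v)"
      by (simp add: C_def prod_nonneg del: traj.simps)
    with True show ?thesis
      unfolding prod.lessThan_Suc_shift C_def by (simp add: mult.commute)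
  next
    case False
    then have "map x [0..<Suc (Suc n)] \<notin> set_pmf (traj s (Suc n) v)"
      unfolding xs using hd_traj by fastforce
    with False show ?thesis by (simp only: set_pmf_iff) simp
  qed
qed

text \<open>The chain rule multiplies transition probabilities, which by translation invariance are
  masses of increments.\<close>

lemma network_random_walk_prob:
  assumes "network_random_walk M lattice_adj (Gamma2_conductance lam) v S"
  shows "\<P>(\<omega> in M. \<forall>i\<le>n. S i \<omega> = x i) = pmf (traj (step lam) n v) (map x [0..<Suc n])"
proof -
  interpret prob_space M using assms by (simp add: network_random_walk_def)
  have S [measurable]: "S i \<in> measurable M (count_space UNIV)" for i
    using assms by (simp add: network_random_walk_def)
  have S0: "AE \<omega> in M. S 0 \<omega> = v"
    using assms by (simp add: network_random_walk_def)
  have markov: "\<P>(\<omega> in M. S (Suc n) \<omega> = y \<bar> \<forall>i\<le>n. S i \<omega> = x i) = pmf (step lam) (y - x n)"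
    if "\<P>(\<omega> in M. \<forall>i\<le>n. S i \<omega> = x i) > 0" for n y
  proof -
    have "network_step_prob lattice_adj (Gamma2_conductance lam) (x n) y = pmf (step lam) (y - x n)"
      unfolding network_step_prob_translate[of lam "x n"] pmf_step_eq ..
    moreover
    have "\<forall>n x y. \<P>(\<omega> in M. \<forall>i\<le>n. S i \<omega> = x i) > 0 \<longrightarrow>
        \<P>(\<omega> in M. S (Suc n) \<omega> = y \<bar> \<forall>i\<le>n. S i \<omega> = x i)
          = network_step_prob lattice_adj (Gamma2_conductance lam) (x n) y"
      using assms unfolding network_random_walk_def by (elim conjE)
    from this[rule_format, OF that] have "\<P>(\<omega> in M. S (Suc n) \<omega> = y \<bar> \<forall>i\<le>n. S i \<omega> = x i)
        = network_step_prob lattice_adj (Gamma2_conductance lam) (x n) y" .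
    ultimately show ?thesis by (rule trans[rotated])
  qed
  have "\<P>(\<omega> in M. \<forall>i\<le>n. S i \<omega> = x i) = (if x 0 = v then \<Prod>i<n. pmf (step lam) (x (Suc i) - x i) else 0)"
  proof (induction n)
    case 0
    have "\<P>(\<omega> in M. \<forall>i\<le>0. S i \<omega> = x i) = \<P>(\<omega> in M. v = x 0)"
      using S0 by (intro prob_eq_AE) auto
    then show ?case by (auto simp: prob_space)
  next
    case (Suc n)
    define p where "p = \<P>(\<omega> in M. \<forall>i\<le>n. S i \<omega> = x i)"
    define p' where "p' = \<P>(\<omega> in M. S (Suc n) \<omega> = x (Suc n) \<and> (\<forall>i\<le>n. S i \<omega> = x i))"
    have "p' = p * pmf (step lam) (x (Suc n) - x n)"
    proof (cases "p > 0")
      case True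
      then have "p' / p = pmf (step lam) (x (Suc n) - x n)"
        using markov[of n "x (Suc n)"] by (simp only: cond_prob_def p_def p'_def)
      with True show ?thesis by (simp add: nonzero_divide_eq_eq mult.commute)
    next
      \<comment> \<open>The Markov property is silent about a past of probability 0, but every
        extension of it has probability 0 as well.\<close>
      case False
      moreover have "0 \<le> p" by (simp add: p_def)
      ultimately have "p = 0" by linarith
      moreover have "p' \<le> p" unfolding p_def p'_def by (intro finite_measure_mono) auto
      moreover have "0 \<le> p'" by (simp add: p'_def)
      ultimately show ?thesis by simp
    qed
    moreover have "\<P>(\<omega> in M. \<forall>i\<le>Suc n. S i \<omega> = x i) = p'"
      unfolding p'_def by (intro arg_cong[where f = prob] Collect_cong) (auto simp: le_Suc_eq)
    ultimately show ?case
      using Suc.IH[folded p_def] by simp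
  qed
  then show ?thesis by (simp only: pmf_traj)
qed

section \<open>The joint law of two finite trajectories\<close>

lemma measurable_trajectory:
  fixes S :: "nat \<Rightarrow> 'w \<Rightarrow> 'v::countable"
  assumes "\<And>i. S i \<in> measurable M (count_space UNIV)"
  shows "(\<lambda>\<omega>. map (\<lambda>i. S i \<omega>) is) \<in> measurable M (count_space UNIV)"
proof (induction "is")
  case (Cons i "is")
  have "(\<lambda>\<omega>. (case (S i \<omega>, map (\<lambda>i. S i \<omega>) is) of (a, as) \<Rightarrow> a # as)) \<in> measurable M (count_space UNIV)"
    by (rule measurable_compose[OF measurable_Pair[OF assms Cons]])
      (simp add: pair_measure_countable)
  then show ?case by simp
qed simp

text \<open>Pairs of lists form a countable set, so singletons decide. Two lists of length
  \<open>Suc n\<close> describe a product of cylinder events, to which independence applies; other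
  lengths have mass 0 on both sides.\<close>

lemma joint_trajectory_law:
  assumes w: "network_random_walk M lattice_adj (Gamma2_conductance lam) v S"
    and w': "network_random_walk M lattice_adj (Gamma2_conductance lam) v' S'"
    and ind: "independent_processes M S S'"
  shows "distr M (count_space UNIV) (\<lambda>\<omega>. (map (\<lambda>i. S i \<omega>) [0..<Suc n], map (\<lambda>i. S' i \<omega>) [0..<Suc n]))
     = measure_pmf (pair_pmf (traj (step lam) n v) (traj (step lam) n v'))"
    (is "distr M _ ?T = measure_pmf ?P")
proof (rule measure_eqI_countable[where A = UNIV])
  interpret prob_space M using w by (simp add: network_random_walk_def)
  have S: "S i \<in> measurable M (count_space UNIV)" and S': "S' i \<in> measurable M (count_space UNIV)" for i
    using w w' by (simp_all add: network_random_walk_def)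
  have T: "?T \<in> measurable M (count_space UNIV)"
    using measurable_Pair[OF measurable_trajectory[OF S] measurable_trajectory[OF S']]
    by (simp add: pair_measure_countable del: upt_Suc)
  fix z :: "vertex list \<times> vertex list"
  obtain a b where z: "z = (a, b)" by (cases z)
  have lhs: "emeasure (distr M (count_space UNIV) ?T) {z} = emeasure M (?T -` {z} \<inter> space M)"
    by (rule emeasure_distr[OF T]) simp
  show "emeasure (distr M (count_space UNIV) ?T) {z} = emeasure ?P {z}"
  proof (cases "length a = Suc n \<and> length b = Suc n")
    case True
    then have ab: "a = map ((!) a) [0..<Suc n]" "b = map ((!) b) [0..<Suc n]"
      by (metis map_nth)+
    have eq: "map (\<lambda>i. R i \<omega>) [0..<Suc n] = c \<longleftrightarrow> (\<forall>i\<le>n. R i \<omega> = c ! i)"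
      if "length c = Suc n" for R :: "nat \<Rightarrow> 'w \<Rightarrow> vertex" and c \<omega>
      using that by (auto simp: list_eq_iff_nth_eq less_Suc_eq_le simp del: upt_Suc)
    \<comment> \<open>Cylinder sets carry events about lists over to the product sigma-algebra of
      \<open>independent_processes\<close>.\<close>
    define A :: "vertex list \<Rightarrow> (nat \<Rightarrow> vertex) set" where "A c = {f. \<forall>i\<le>n. f i = c ! i}" for c
    have A: "A c \<in> sets (PiM UNIV (\<lambda>_. count_space UNIV))" for c
    proof -
      have "{f \<in> space (PiM UNIV (\<lambda>_::nat. count_space (UNIV :: vertex set))). \<forall>i\<in>{..n}. f i = c ! i}
          \<in> sets (PiM UNIV (\<lambda>_. count_space UNIV))"
        by measurable
      then show ?thesis by (simp add: A_def space_PiM Ball_def)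
    qed
    have "emeasure M (?T -` {z} \<inter> space M)
        = emeasure M ((\<lambda>\<omega>. (\<lambda>n. S n \<omega>, \<lambda>n. S' n \<omega>)) -` (A a \<times> A b) \<inter> space M)"
      using True by (intro arg_cong[where f = "emeasure M"]) (auto simp: z A_def eq simp del: upt_Suc)
    also have "\<dots> = ennreal (prob ((\<lambda>\<omega> n. S n \<omega>) -` A a \<inter> space M) * prob ((\<lambda>\<omega> n. S' n \<omega>) -` A b \<inter> space M))"
      using indep_varD[OF ind[unfolded independent_processes_def] A A] by (simp add: emeasure_eq_measure)
    also have "(\<lambda>\<omega> n. S n \<omega>) -` A a \<inter> space M = {\<omega> \<in> space M. \<forall>i\<le>n. S i \<omega> = a ! i}"
      by (auto simp: A_def)
    also have "(\<lambda>\<omega> n. S' n \<omega>) -` A b \<inter> space M = {\<omega> \<in> space M. \<forall>i\<le>n. S' i \<omega> = b ! i}"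
      by (auto simp: A_def)
    also have "ennreal (prob {\<omega> \<in> space M. \<forall>i\<le>n. S i \<omega> = a ! i} * prob {\<omega> \<in> space M. \<forall>i\<le>n. S' i \<omega> = b ! i})
        = emeasure ?P {z}"
      unfolding network_random_walk_prob[OF w] network_random_walk_prob[OF w'] ab[symmetric]
      by (simp add: emeasure_pmf_single z pmf_pair)
    finally show ?thesis by (simp only: lhs)
  next
    case False
    then have "?T -` {z} \<inter> space M = {}" by (auto simp: z simp del: upt_Suc)
    moreover have "z \<notin> set_pmf ?P" using False length_traj by (auto simp: z)
    then have "pmf ?P z = 0" by (simp only: set_pmf_iff) simp
    ultimately show ?thesis
      unfolding lhs emeasure_pmf_single by (simp only: emeasure_empty ennreal_0)
  qed
qed auto

text \<open>Restarted at time \<open>N\<close>, the walks have independent random starts;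
  \<open>hit\<close> is 1 for every pair of starts, hence also on average.\<close>

lemma intersection_after:
  assumes lam: "lam > 0"
    and w: "network_random_walk M lattice_adj (Gamma2_conductance lam) v S"
    and w': "network_random_walk M lattice_adj (Gamma2_conductance lam) v' S'"
    and ind: "independent_processes M S S'"
  shows "AE \<omega> in M. \<exists>m\<ge>N. \<exists>m'\<ge>N. S m \<omega> = S' m' \<omega>"
proof -
  interpret prob_space M using w by (simp add: network_random_walk_def)
  have S [measurable]: "S i \<in> measurable M (count_space UNIV)" "S' i \<in> measurable M (count_space UNIV)" for i
    using w w' by (simp_all add: network_random_walk_def)
  let ?s = "step lam"
  define E where "E = {\<omega> \<in> space M. \<exists>m\<ge>N. \<exists>m'\<ge>N. S m \<omega> = S' m' \<omega>}"
  have E [measurable]: "E \<in> sets M" unfolding E_def by measurable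
  have "(\<integral>\<^sup>+a. \<integral>\<^sup>+b. hit_upto ?s k k a b \<partial>walk ?s N v' \<partial>walk ?s N v) \<le> emeasure M E" for k
  proof -
    let ?T = "\<lambda>\<omega>. (map (\<lambda>i. S i \<omega>) [0..<Suc (N + k)], map (\<lambda>i. S' i \<omega>) [0..<Suc (N + k)])"
    let ?D = "{(xs, ys). set (drop N xs) \<inter> set (drop N ys) \<noteq> {}} :: (vertex list \<times> vertex list) set"
    have T: "?T \<in> measurable M (count_space UNIV)"
      using measurable_Pair[OF measurable_trajectory[OF S(1)] measurable_trajectory[OF S(2)]]
      by (simp add: pair_measure_countable del: upt_Suc)
    have "(\<integral>\<^sup>+a. \<integral>\<^sup>+b. hit_upto ?s k k a b \<partial>walk ?s N v' \<partial>walk ?s N v)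
        = emeasure (pair_pmf (map_pmf (drop N) (traj ?s (N + k) v)) (map_pmf (drop N) (traj ?s (N + k) v')))
            {(xs, ys). set xs \<inter> set ys \<noteq> {}}"
      unfolding map_drop_traj pair_bind_pmf hit_upto_def by simp
    also have "\<dots> = emeasure (pair_pmf (traj ?s (N + k) v) (traj ?s (N + k) v')) ?D"
      unfolding map_pair[symmetric] emeasure_map_pmf by (simp add: vimage_def case_prod_beta')
    also have "\<dots> = emeasure M (?T -` ?D \<inter> space M)"
      unfolding joint_trajectory_law[OF w w' ind, symmetric] by (rule emeasure_distr[OF T]) simp
    also have "\<dots> \<le> emeasure M E"
    \<comment> \<open>After dropping \<open>N\<close> entries only times at least \<open>N\<close>
      remain, so a common entry is an intersection counted in \<open>E\<close>.\<close>
    proof (rule emeasure_mono[OF _ E])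
      have drop: "set (drop N (map f [0..<Suc (N + k)])) = f ` {N..<Suc (N + k)}" for f :: "nat \<Rightarrow> vertex"
        by (simp add: drop_map del: upt_Suc)
      show "?T -` ?D \<inter> space M \<subseteq> E"
      proof
        fix \<omega> assume "\<omega> \<in> ?T -` ?D \<inter> space M"
        then have "\<omega> \<in> space M" and "(\<lambda>i. S i \<omega>) ` {N..<Suc (N + k)} \<inter> (\<lambda>i. S' i \<omega>) ` {N..<Suc (N + k)} \<noteq> {}"
          unfolding drop[symmetric] by (simp_all del: upt_Suc)
        moreover from this(2) obtain m m' where "m \<in> {N..<Suc (N + k)}" "m' \<in> {N..<Suc (N + k)}" "S m \<omega> = S' m' \<omega>"
          by blast
        ultimately show "\<omega> \<in> E"
          unfolding E_def atLeastLessThan_iff by blast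
      qed
    qed
    finally show ?thesis .
  qed
  then have "(SUP k. \<integral>\<^sup>+a. \<integral>\<^sup>+b. hit_upto ?s k k a b \<partial>walk ?s N v' \<partial>walk ?s N v) \<le> emeasure M E"
    by (rule SUP_least)
  \<comment> \<open>Monotone convergence moves the supremum inside, where it becomes
    \<open>hit\<close>, which is identically 1.\<close>
  moreover have "(SUP k. \<integral>\<^sup>+a. \<integral>\<^sup>+b. hit_upto ?s k k a b \<partial>walk ?s N v' \<partial>walk ?s N v) = 1"
  proof -
    have "(SUP k. \<integral>\<^sup>+z. hit_upto ?s k k (fst z) (snd z) \<partial>pair_pmf (walk ?s N v) (walk ?s N v'))
        = (\<integral>\<^sup>+z. (SUP k. hit_upto ?s k k (fst z) (snd z)) \<partial>pair_pmf (walk ?s N v) (walk ?s N v'))"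
      by (rule nn_integral_monotone_convergence_SUP[symmetric])
        (auto intro!: incseq_SucI le_funI hit_upto_mono)
    also have "\<dots> = 1"
      unfolding hit_def[symmetric] hit_eq_1[OF lam] by simp
    finally show ?thesis by (simp add: nn_integral_pair_pmf')
  qed
  ultimately have "emeasure M E = 1"
    using emeasure_le_1[of E] by (metis antisym)
  then have "prob E = 1" by (simp add: emeasure_eq_measure)
  then have "AE \<omega> in M. \<omega> \<in> E" using E by (simp add: prob_eq_1)
  then show ?thesis by (rule AE_mp) (simp add: E_def)
qed

theorem mainTheorem8:
  fixes lam :: real and M :: "'w measure" and v v' :: vertex
    and S S' :: "nat \<Rightarrow> 'w \<Rightarrow> vertex"
  assumes "lam > 0"
    and "network_random_walk M lattice_adj (Gamma2_conductance lam) v S"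
    and "network_random_walk M lattice_adj (Gamma2_conductance lam) v' S'"
    and "independent_processes M S S'"
  shows "AE \<omega> in M. infinite {(m, m'). S m \<omega> = S' m' \<omega>}"
proof -
  have "AE \<omega> in M. \<forall>N. \<exists>m\<ge>N. \<exists>m'\<ge>N. S m \<omega> = S' m' \<omega>"
    unfolding AE_all_countable using intersection_after[OF assms] by blast
  then show ?thesis
  proof (rule AE_mp, intro AE_I2 impI notI)
    fix \<omega> assume late: "\<forall>N. \<exists>m\<ge>N. \<exists>m'\<ge>N. S m \<omega> = S' m' \<omega>"
      and fin: "finite {(m, m'). S m \<omega> = S' m' \<omega>}"
    \<comment> \<open>Finitely many pairs would bound the first times by some \<open>N\<close>,
      against an intersection with \<open>m \<ge> N\<close>.\<close>
    then obtain N where "\<forall>m\<in>fst ` {(m, m'). S m \<omega> = S' m' \<omega>}. m < N"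
      using finite_nat_set_iff_bounded[of "fst ` {(m, m'). S m \<omega> = S' m' \<omega>}"] by blast
    moreover obtain m m' where "m \<ge> N" "S m \<omega> = S' m' \<omega>" using late by blast
    moreover from this(2) have "m \<in> fst ` {(m, m'). S m \<omega> = S' m' \<omega>}"
      by (intro image_eqI[of _ _ "(m, m')"]) simp_all
    ultimately show False using linorder_not_less by blast
  qed
qed

end
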